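(* Let $L$ be an infinite porous subset of $\mathbb{N}$. For each integer $\ell \geq 1$ there exists a projective planar graph $G$ such that $G$ does not contain two vertex-disjoint $L$-cycles, and for every $X \subseteq V(G)$ with $|X| \leq \ell$, the graph $G - X$ contains $L$-cycles of at least $\ell$ distinct lengths.
   Context: $\mathbb{N}$ denotes the set of positive integers. Graphs are finite. For $L \subseteq \mathbb{N}$, an $L$-cycle is a cycle whose length (number of edges) lies in $L$. A set $L \subseteq \mathbb{N}$ is porous if for every $n \in \mathbb{N}$, the set $\mathbb{N}\setminus L$ contains $n$ consecutive integers. A graph is projective planar if it can be embedded in the projective plane. *)

theory Defs
  imports "HOL-Analysis.Analysis"
begin

definition porous :: "nat set \<Rightarrow> bool" where
  "porous L \<longleftrightarrow> (\<forall>n\<ge>1. \<exists>m\<ge>1. {m..<m + n} \<subseteq> {1..} - L)"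


section \<open>Finite simple graphs\<close>

definition finite_graph :: "'a set \<Rightarrow> 'a set set \<Rightarrow> bool" where
  "finite_graph V E \<longleftrightarrow> finite V \<and> (\<forall>e\<in>E. e \<subseteq> V \<and> card e = 2)"

text \<open>A cycle is given by the cyclic sequence of its vertices, so that the length of the list is
  also its number of edges. A cycle of a simple graph has at least three vertices.\<close>

definition is_cycle :: "'a set \<Rightarrow> 'a set set \<Rightarrow> 'a list \<Rightarrow> bool" where
  "is_cycle V E c \<longleftrightarrow> length c \<ge> 3 \<and> distinct c \<and> set c \<subseteq> V \<and>
     (\<forall>i<length c. {c ! i, c ! (Suc i mod length c)} \<in> E)"

definition L_cycle :: "nat set \<Rightarrow> 'a set \<Rightarrow> 'a set set \<Rightarrow> 'a list \<Rightarrow> bool" where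
  "L_cycle L V E c \<longleftrightarrow> is_cycle V E c \<and> length c \<in> L"

text \<open>The graph obtained by deleting the vertices in \<open>X\<close> is \<open>(V - X, delete_edges E X)\<close>.\<close>

definition delete_edges :: "'a set set \<Rightarrow> 'a set \<Rightarrow> 'a set set" where
  "delete_edges E X = {e \<in> E. e \<inter> X = {}}"


section \<open>Embeddings in the projective plane\<close>

text \<open>The projective plane is the 2-sphere with antipodal points identified, with the quotient
  topology.\<close>

definition antipodal_class :: "real ^ 3 \<Rightarrow> (real ^ 3) set" where
  "antipodal_class x = {x, - x}"

definition projective_plane :: "(real ^ 3) set topology" where
  "projective_plane = topology (\<lambda>U. U \<subseteq> antipodal_class ` sphere 0 1 \<and>
     openin (top_of_set (sphere 0 1)) {x \<in> sphere 0 1. antipodal_class x \<in> U})"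

lemma istopology_projective_plane:
  "istopology (\<lambda>U. U \<subseteq> antipodal_class ` sphere 0 1 \<and>
     openin (top_of_set (sphere 0 1)) {x \<in> sphere 0 1. antipodal_class x \<in> U})"
proof -
  have 1: "{x \<in> sphere 0 1. antipodal_class x \<in> S \<inter> T} =
      {x \<in> sphere 0 1. antipodal_class x \<in> S} \<inter> {x \<in> sphere 0 1. antipodal_class x \<in> T}" for S T
    by auto
  have 2: "{x \<in> sphere 0 1. antipodal_class x \<in> \<Union> K} =
      (\<Union>S\<in>K. {x \<in> sphere 0 1. antipodal_class x \<in> S})" for K
    by auto
  show ?thesis
    unfolding istopology_def 1 2 by blast
qed

lemma openin_projective_plane:
  "openin projective_plane U \<longleftrightarrow> U \<subseteq> antipodal_class ` sphere 0 1 \<and>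
     openin (top_of_set (sphere 0 1)) {x \<in> sphere 0 1. antipodal_class x \<in> U}"
  unfolding projective_plane_def topology_inverse'[OF istopology_projective_plane] ..

lemma topspace_projective_plane: "topspace projective_plane = antipodal_class ` sphere 0 1"
proof -
  have "{x \<in> sphere 0 1. antipodal_class x \<in> antipodal_class ` sphere 0 1} = sphere 0 1"
    by auto
  then have "openin projective_plane (antipodal_class ` sphere 0 1)"
    by (simp add: openin_projective_plane del: mem_sphere_0)
  then show ?thesis
    by (metis openin_projective_plane openin_subset openin_topspace subset_antisym)
qed

lemma quotient_map_projective_plane:
  "quotient_map (top_of_set (sphere 0 1)) projective_plane antipodal_class"
  by (simp add: quotient_map_def topspace_projective_plane openin_projective_plane del: mem_sphere_0)

text \<open>Vertices are drawn as distinct points, and each edge as an arc joining its two ends. The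
  interior of an arc contains no vertex and meets no other arc.\<close>

definition graph_embedding ::
  "'b topology \<Rightarrow> 'a set \<Rightarrow> 'a set set \<Rightarrow> ('a \<Rightarrow> 'b) \<Rightarrow> ('a set \<Rightarrow> real \<Rightarrow> 'b) \<Rightarrow> bool" where
  "graph_embedding X V E \<phi> \<gamma> \<longleftrightarrow>
     \<phi> ` V \<subseteq> topspace X \<and> inj_on \<phi> V \<and>
     (\<forall>e\<in>E. pathin X (\<gamma> e) \<and> inj_on (\<gamma> e) {0..1} \<and> {\<gamma> e 0, \<gamma> e 1} = \<phi> ` e) \<and>
     (\<forall>e\<in>E. \<gamma> e ` {0<..<1} \<inter> \<phi> ` V = {}) \<and>
     (\<forall>e\<in>E. \<forall>f\<in>E. e \<noteq> f \<longrightarrow> \<gamma> e ` {0<..<1} \<inter> \<gamma> f ` {0..1} = {})"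

definition projective_planar :: "'a set \<Rightarrow> 'a set set \<Rightarrow> bool" where
  "projective_planar V E \<longleftrightarrow> (\<exists>\<phi> \<gamma>. graph_embedding projective_plane V E \<phi> \<gamma>)"

end

(*
  Take n = 3l tangents of a conic in the projective plane, subdivided. Deleting l vertices destroys
  at most 2l of these lines, so it suffices that every line is an L-cycle, that the lines have
  distinct lengths, and that any two L-cycles meet. Each line has one segment through infinity.
  Porosity allows segment lengths that make every cycle through no such segment, or through
  at least two of them, have its length in a gap of L: the longest segment determines the gap and
  all shorter ones together are too short to leave it. Two cycles that pass through infinity exactly
  once meet, by a colouring of the faces of the arrangement modulo 2.
*)

theory Submission
  imports Defs "HOL-Library.Z2"
begin

section \<open>Tangents of a conic in the projective plane\<close>

text \<open>Closed curves in the projective plane are forced to meet only if each crosses the line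
  at infinity an odd number of times, so lengths have to eliminate the other cycles. Infinity can be
  taken to be one more tangent, with parameter strictly between \<open>n - 1\<close> and
  \<open>n\<close>: it cuts each line in exactly one segment, from crossing \<open>n - 1\<close>
  back to crossing \<open>0\<close>. Tangents of a conic are convenient because a point is then an
  unordered pair of parameters and every line carries its crossings in the same cyclic order, which
  makes the drawing and the face colouring explicit. The meeting of cycles is proved combinatorially
  from parities of degrees, without the Jordan curve theorem; topology enters only in the
  drawing.\<close>

text \<open>Up to a linear change of coordinates, \<open>tangent_pt n a b\<close> is the symmetric product of the directions
  with angles \<open>pi * a / n\<close> and \<open>pi * b / n\<close>, that is, the intersection of two tangents of a conic.
  So it depends only on the unordered pair, and up to sign only on \<open>a\<close> and \<open>b\<close> modulo \<open>n\<close>.\<close>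

definition tangent_pt :: "nat \<Rightarrow> real \<Rightarrow> real \<Rightarrow> real ^ 3" where
  "tangent_pt n a b = vector [cos (pi * (a + b) / n), sin (pi * (a + b) / n), cos (pi * (a - b) / n)]"

definition pt :: "nat \<Rightarrow> real \<Rightarrow> real \<Rightarrow> (real ^ 3) set" where
  "pt n a b = antipodal_class (sgn (tangent_pt n a b))"

lemma tangent_pt_nth [simp]:
  "tangent_pt n a b $ 1 = cos (pi * (a + b) / n)"
  "tangent_pt n a b $ 2 = sin (pi * (a + b) / n)"
  "tangent_pt n a b $ 3 = cos (pi * (a - b) / n)"
  by (simp_all add: tangent_pt_def)

lemma tangent_pt_nonzero: "tangent_pt n a b \<noteq> 0"
proof
  assume "tangent_pt n a b = 0"
  then have "tangent_pt n a b $ 1 = 0" "tangent_pt n a b $ 2 = 0"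
    by (metis zero_index)+
  then have "cos (pi * (a + b) / n) = 0" "sin (pi * (a + b) / n) = 0"
    by simp_all
  then show False
    by (metis sin_zero_abs_cos_one abs_zero zero_neq_one)
qed

lemma pt_commute: "pt n a b = pt n b a"
proof -
  have "cos (pi * (a - b) / n) = cos (pi * (b - a) / n)"
    by (metis cos_minus minus_diff_eq minus_divide_left mult_minus_right)
  then have "tangent_pt n a b = tangent_pt n b a"
    by (simp add: tangent_pt_def add.commute)
  then show ?thesis by (simp add: pt_def)
qed

text \<open>Both angles change by a half turn, so all three coordinates change sign: the parameter
  runs around a closed projective line.\<close>

lemma pt_periodic:
  assumes "n > 0"
  shows "pt n a (b + real n) = pt n a b"
proof -
  have 1: "pi * (a + (b + real n)) / n = pi * (a + b) / n + pi"
    and 2: "pi * (a - (b + real n)) / n = pi * (a - b) / n - pi"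
    using assms by (simp_all add: field_simps)
  have "tangent_pt n a (b + real n) = - tangent_pt n a b"
    unfolding vec_eq_iff forall_3 uminus_vec_def using 1 2 by simp
  then show ?thesis
    by (simp add: pt_def antipodal_class_def sgn_minus insert_commute)
qed

lemma pt_in_topspace: "pt n a b \<in> topspace projective_plane"
  unfolding pt_def topspace_projective_plane
  by (rule imageI) (simp add: norm_sgn tangent_pt_nonzero)

text \<open>The linear functional \<open>f\<close> of the proof defines the tangent with parameter \<open>c\<close>.\<close>

lemma pt_eq_imp_sin_zero:
  assumes "pt n a b = pt n a' b'"
  shows "sin (pi * (a' - c) / n) * sin (pi * (b' - c) / n) = 0 \<longleftrightarrow>
         sin (pi * (a - c) / n) * sin (pi * (b - c) / n) = 0"
proof -
  define f :: "real ^ 3 \<Rightarrow> real"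
    where "f v = v $ 3 - cos (2 * (pi * c / n)) * v $ 1 - sin (2 * (pi * c / n)) * v $ 2" for v
  \<comment> \<open>By the product-to-sum formula \<open>f\<close> factors on symmetric products, so
    it vanishes exactly when \<open>x\<close> or \<open>y\<close> is \<open>c\<close> modulo
    \<open>n\<close>.\<close>
  have f: "f (tangent_pt n x y) = 2 * (sin (pi * (x - c) / n) * sin (pi * (y - c) / n))" for x y
  proof -
    define \<alpha> \<beta> \<theta> where "\<alpha> = pi * x / n" and "\<beta> = pi * y / n" and "\<theta> = pi * c / n"
    have eqs: "pi * (x + y) / n = \<alpha> + \<beta>" "pi * (x - y) / n = \<alpha> - \<beta>"
      "pi * (x - c) / n = \<alpha> - \<theta>" "pi * (y - c) / n = \<beta> - \<theta>"
      by (simp_all add: \<alpha>_def \<beta>_def \<theta>_def add_divide_distrib diff_divide_distrib algebra_simps)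
    have "f (tangent_pt n x y) = cos (\<alpha> - \<beta>) - (cos (2 * \<theta>) * cos (\<alpha> + \<beta>) + sin (2 * \<theta>) * sin (\<alpha> + \<beta>))"
      unfolding f_def tangent_pt_nth eqs \<theta>_def by simp
    also have "\<dots> = cos (\<alpha> - \<beta>) - cos (\<alpha> + \<beta> - 2 * \<theta>)"
      by (simp add: cos_diff)
    also have "\<dots> = cos ((\<alpha> - \<theta>) - (\<beta> - \<theta>)) - cos ((\<alpha> - \<theta>) + (\<beta> - \<theta>))"
      by (simp add: algebra_simps)
    also have "\<dots> = 2 * (sin (\<alpha> - \<theta>) * sin (\<beta> - \<theta>))"
      unfolding cos_diff[of "\<alpha> - \<theta>"] cos_add[of "\<alpha> - \<theta>"] by simp
    finally show ?thesis unfolding eqs .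
  qed
  have fs: "f (r *\<^sub>R v) = r * f v" for r v
    by (simp add: f_def algebra_simps)
  have *: "f (sgn v) = 0 \<longleftrightarrow> f v = 0" if "v \<noteq> 0" for v
    using that by (simp add: sgn_div_norm fs)
  have fm: "f (- v) = - f v" for v
    by (simp add: f_def)
  have "sgn (tangent_pt n a b) \<in> antipodal_class (sgn (tangent_pt n a' b'))"
    using assms by (auto simp: pt_def antipodal_class_def)
  then have "f (sgn (tangent_pt n a b)) = 0 \<longleftrightarrow> f (sgn (tangent_pt n a' b')) = 0"
    by (auto simp: antipodal_class_def fm)
  then show ?thesis
    by (simp add: * tangent_pt_nonzero f)
qed

lemma sin_pi_quotient_zero_iff:
  fixes x :: real
  assumes "\<bar>x\<bar> < real n"
  shows "sin (pi * x / n) = 0 \<longleftrightarrow> x = 0"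
proof
  assume "sin (pi * x / n) = 0"
  moreover have "n > 0"
    using assms by (cases n) auto
  then have "\<bar>pi * x / n\<bar> < pi"
    using assms by (simp add: abs_mult field_simps)
  then have "- pi < pi * x / n" "pi * x / n < pi"
    by linarith+
  ultimately have "pi * x / n = 0"
    by (rule sin_eq_0_pi[rotated 2])
  with \<open>n > 0\<close> show "x = 0" by simp
qed simp

text \<open>A tangent passes through both points or neither. Testing the four tangents
  \<open>a\<close>, \<open>b\<close>, \<open>a'\<close>, \<open>b'\<close> gives equality of the two
  parameter sets, which determines the unordered pair.\<close>

lemma pt_eqD:
  assumes "pt n a b = pt n a' b'"
    and "0 \<le> a" "a < real n" "0 \<le> b" "b < real n" "0 \<le> a'" "a' < real n" "0 \<le> b'" "b' < real n"
  shows "(a = a' \<and> b = b') \<or> (b = a' \<and> b' = a)"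
proof -
  have z: "sin (pi * (x - c) / n) = 0 \<longleftrightarrow> x = c"
    if "0 \<le> x" "x < real n" "0 \<le> c" "c < real n" for x c
    using sin_pi_quotient_zero_iff[of "x - c" n] that by (auto simp: abs_less_iff)
  have "a' = c \<or> b' = c \<longleftrightarrow> a = c \<or> b = c" if "0 \<le> c" "c < real n" for c
    using pt_eq_imp_sin_zero[OF assms(1), of c] that assms by (simp add: z)
  from this[of a] this[of b] this[of a'] this[of b'] assms(2-) show ?thesis
    by auto
qed

lemma pathin_pt:
  assumes "n > 0"
  shows "pathin projective_plane (\<lambda>s. pt n a (b + s * h))"
proof -
  let ?f = "\<lambda>s. sgn (tangent_pt n a (b + s * h))"
  have "continuous_on {0..1} (\<lambda>s. tangent_pt n a (b + s * h) $ i)" for i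
    by (cases rule: exhaust_3[of i, THEN disjE]; (elim disjE)?; simp; intro continuous_intros; simp add: assms)
  then have "continuous_on {0..1} (\<lambda>s. \<chi> i. tangent_pt n a (b + s * h) $ i)"
    by (intro continuous_on_vec_lambda)
  then have "continuous_on {0..1} (\<lambda>s. tangent_pt n a (b + s * h))"
    by simp
  then have "continuous_on {0..1} ?f"
    unfolding sgn_div_norm
    by (intro continuous_intros) (auto simp: tangent_pt_nonzero)
  moreover have "?f ` {0..1} \<subseteq> sphere 0 1"
    by (auto simp: norm_sgn tangent_pt_nonzero)
  ultimately have "continuous_map (top_of_set {0..1}) (top_of_set (sphere 0 1)) ?f"
    by (auto simp: continuous_map_in_subtopology)
  then have "continuous_map (top_of_set {0..1}) projective_plane (antipodal_class \<circ> ?f)"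
    using quotient_imp_continuous_map[OF quotient_map_projective_plane] continuous_map_compose by blast
  then show ?thesis
    by (simp add: pathin_def pt_def comp_def)
qed

section \<open>Cycles in line arrangements modulo 2\<close>

declare add_bit_eq_xor [simp del] mult_bit_eq_and [simp del]

lemma bit_add_self [simp]: "a + a = (0::bit)"
  by (cases a) (simp_all flip: add.assoc)

lemma bit_add_left_self [simp]: "a + (a + b) = (b::bit)"
  by (cases a) (simp_all flip: add.assoc)

lemma bit_add_eq_0_iff: "a + b = 0 \<longleftrightarrow> a = (b::bit)"
  by (metis bit_add_left_self bit_add_self add_0_right)

lemma bit_telescope: "(\<Sum>k<m. f k + f (Suc k)) = (f 0 + f m :: bit)"
  by (induction m) (simp_all add: algebra_simps)

text \<open>Off-diagonal entries cancel in pairs. This serves as a handshake lemma: each crossing is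
  counted once from either of its lines.\<close>

lemma bit_sum_symmetric:
  fixes A :: "nat \<Rightarrow> nat \<Rightarrow> bit"
  assumes "\<And>i j. i < n \<Longrightarrow> j < n \<Longrightarrow> i \<noteq> j \<Longrightarrow> A i j = A j i" and "\<And>i. i < n \<Longrightarrow> A i i = 0"
  shows "(\<Sum>i<n. \<Sum>j<n. A i j) = 0"
  using assms
proof (induction n)
  case (Suc n)
  have "(\<Sum>i<n. A i n) = (\<Sum>j<n. A n j)"
    using Suc.prems by (intro sum.cong) auto
  then show ?case
    using Suc by (simp add: sum.distrib algebra_simps)
qed simp

text \<open>Cell \<open>a \<le> n\<close> of a line lies between its crossings with the lines \<open>a - 1\<close> and \<open>a\<close>; cells \<open>0\<close> and
  \<open>n\<close> coincide at infinity. The bit \<open>c k a\<close> records whether a cycle runs along cell \<open>a\<close> of line \<open>k\<close>.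
  Line \<open>i\<close> touches the conic at the dummy crossing \<open>{i, i}\<close>.\<close>

definition mod2_cycle :: "nat \<Rightarrow> (nat \<Rightarrow> nat \<Rightarrow> bit) \<Rightarrow> bool" where
  "mod2_cycle n c \<longleftrightarrow> (\<forall>i<n. c i 0 = c i n \<and> c i i = c i (Suc i)) \<and>
     (\<forall>i<n. \<forall>j<n. c i j + c i (Suc j) = c j i + c j (Suc i))"

text \<open>The pair \<open>(a, b)\<close> stands for the face where a generic tangent with parameter in cell \<open>a\<close> meets one
  with parameter in cell \<open>b\<close>. The colour counts how often \<open>c\<close> is met on the first tangent on the way
  from infinity; the second sum makes it symmetric, at the price of a jump at infinity.\<close>

definition face_colour :: "(nat \<Rightarrow> nat \<Rightarrow> bit) \<Rightarrow> nat \<Rightarrow> nat \<Rightarrow> bit" where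
  "face_colour c a b = (\<Sum>k<b. c k a) + (\<Sum>k<a. c k 0)"

text \<open>The cycle condition at the crossings of line \<open>i\<close> with the lines
  \<open>k < b\<close> telescopes along line \<open>i\<close>. It leaves an extra
  \<open>c i 0\<close>, which the second sum in \<open>face_colour\<close> cancels.\<close>

lemma face_colour_step:
  assumes "mod2_cycle n c" "i < n" "b \<le> n"
  shows "face_colour c (Suc i) b = face_colour c i b + c i b"
proof -
  have "(\<Sum>k<b. c k i + c k (Suc i)) = (\<Sum>k<b. c i k + c i (Suc k))"
    using assms by (intro sum.cong) (auto simp: mod2_cycle_def)
  then have "(\<Sum>k<b. c k i) + (\<Sum>k<b. c k (Suc i)) = c i 0 + c i b"
    unfolding bit_telescope by (simp add: sum.distrib)
  then have "(\<Sum>k<b. c k (Suc i)) = (\<Sum>k<b. c k i) + c i 0 + c i b"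
    by (metis bit_add_left_self add.assoc)
  then show ?thesis
    by (simp add: face_colour_def algebra_simps)
qed

lemma face_colour_step':
  "face_colour c a (Suc i) = face_colour c a i + c i a"
  by (simp add: face_colour_def algebra_simps)

text \<open>Both sides change by \<open>c a b\<close> when \<open>a\<close> grows by one. Symmetry
  is what makes the colour a function of the point, which is an unordered pair.\<close>

lemma face_colour_commute:
  assumes "mod2_cycle n c" "a \<le> n" "b \<le> n"
  shows "face_colour c a b = face_colour c b a"
  using assms(2)
proof (induction a)
  case (Suc a)
  then show ?case
    using face_colour_step[OF assms(1), of a b] assms(3) face_colour_step'[of c b a] by simp
qed (simp add: face_colour_def)

text \<open>If the cycles had no common crossing, the edges of \<open>d\<close> of colour \<open>1\<close> would form a graph with a
  single vertex of odd degree, at infinity.\<close>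

lemma one_sided_cycles_meet:
  assumes c: "mod2_cycle n c" and d: "mod2_cycle n d"
    and "(\<Sum>k<n. c k 0) = 1" "(\<Sum>k<n. d k 0) = 1"
  shows "\<exists>i<n. \<exists>j<n. (d i j \<noteq> 0 \<or> d i (Suc j) \<noteq> 0) \<and>
    (c i j \<noteq> 0 \<or> c i (Suc j) \<noteq> 0 \<or> c j i \<noteq> 0 \<or> c j (Suc i) \<noteq> 0)"
proof (rule ccontr)
  assume "\<not> ?thesis"
  then have disj: "d i j = 0 \<and> d i (Suc j) = 0 \<or>
      c i j = 0 \<and> c i (Suc j) = 0 \<and> c j i = 0 \<and> c j (Suc i) = 0" if "i < n" "j < n" for i j
    using that by blast
  define d' where "d' i a = d i a * face_colour c a i" for i a
  \<comment> \<open>Between cells \<open>j\<close> and \<open>Suc j\<close> of line \<open>i\<close>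
    the colour changes only if \<open>c j i\<close> is 1, and then \<open>disj\<close> makes
    \<open>d\<close> vanish on both cells.\<close>
  have A: "d' i j + d' i (Suc j) = (d i j + d i (Suc j)) * face_colour c i j"
    if "i < n" "j < n" for i j
  proof -
    have "face_colour c j i = face_colour c i j"
      using face_colour_commute[OF c] that by simp
    moreover have "face_colour c (Suc j) i = face_colour c j i + c j i"
      using face_colour_step[OF c] that by simp
    ultimately show ?thesis
      using disj[OF that] by (auto simp: d'_def algebra_simps)
  qed
  have "(\<Sum>i<n. \<Sum>j<n. d' i j + d' i (Suc j)) = 0"
  proof (rule bit_sum_symmetric)
    fix i j assume "i < n" "j < n"
    then show "d' i j + d' i (Suc j) = d' j i + d' j (Suc i)"
      using d face_colour_commute[OF c, of i j] by (simp add: A mod2_cycle_def)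
  next
    fix i assume "i < n"
    then show "d' i i + d' i (Suc i) = 0"
      using d by (simp add: A mod2_cycle_def)
  qed
  \<comment> \<open>Along line \<open>i\<close> only the two ends at infinity remain; their colours
    differ by the number of times \<open>c\<close> passes infinity, which is odd.\<close>
  moreover have "(\<Sum>j<n. d' i j + d' i (Suc j)) = d i 0" if "i < n" for i
  proof -
    have "d i n = d i 0" "(\<Sum>k<i. c k n) = (\<Sum>k<i. c k 0)"
      using c d that by (auto simp: mod2_cycle_def)
    moreover have "face_colour c n i = face_colour c 0 i + 1"
      using calculation assms(3) by (simp add: face_colour_def)
    ultimately show ?thesis
      unfolding bit_telescope by (simp add: d'_def algebra_simps)
  qed
  ultimately show False
    using assms(4) by simp
qed

section \<open>Subdivided line arrangements\<close>

definition cycle_edges :: "'a list \<Rightarrow> 'a set set" where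
  "cycle_edges c = (\<lambda>i. {c ! i, c ! (Suc i mod length c)}) ` {..<length c}"

lemma cycle_edges_subset: "is_cycle V E c \<Longrightarrow> cycle_edges c \<subseteq> E"
  by (auto simp: is_cycle_def cycle_edges_def)

lemma cycle_edge_vertices:
  assumes "e \<in> cycle_edges c"
  shows "e \<subseteq> set c"
proof -
  from assms obtain i where i: "i < length c" "e = {c ! i, c ! (Suc i mod length c)}"
    by (auto simp: cycle_edges_def)
  then have "Suc i mod length c < length c"
    by (intro mod_less_divisor) auto
  with i show ?thesis by simp
qed

text \<open>Two positions with the same edge would be successors of each other, which needs a cycle
  of length two.\<close>

lemma inj_on_cycle_edge:
  assumes "length c \<ge> 3" "distinct c"
  shows "inj_on (\<lambda>i. {c ! i, c ! (Suc i mod length c)}) {..<length c}"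
proof (rule inj_onI)
  let ?s = "\<lambda>i. Suc i mod length c"
  fix i j assume ij: "i \<in> {..<length c}" "j \<in> {..<length c}" "{c ! i, c ! ?s i} = {c ! j, c ! ?s j}"
  moreover have "?s i < length c" "?s j < length c"
    using assms(1) by (auto intro!: mod_less_divisor)
  ultimately have "i = j \<or> i = ?s j \<and> j = ?s i"
    using assms(2) by (auto simp: doubleton_eq_iff nth_eq_iff_index_eq)
  then show "i = j"
    using ij(1,2) assms(1) by (auto simp: mod_Suc split: if_splits)
qed

lemma card_cycle_edges:
  assumes "is_cycle V E c"
  shows "card (cycle_edges c) = length c"
  unfolding cycle_edges_def using assms inj_on_cycle_edge[of c]
  by (subst card_image) (auto simp: is_cycle_def)

lemma even_card_cycle_edges_at:
  assumes "is_cycle V E c"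
  shows "even (card {e \<in> cycle_edges c. v \<in> e})"
proof (cases "v \<in> set c")
  case False
  then have "{e \<in> cycle_edges c. v \<in> e} = {}"
    using cycle_edge_vertices by fastforce
  then show ?thesis by (simp only: card.empty even_zero)
next
  case True
  let ?f = "\<lambda>i. {c ! i, c ! (Suc i mod length c)}"
  have c: "length c \<ge> 3" "distinct c"
    using assms by (auto simp: is_cycle_def)
  obtain i where i: "i < length c" "v = c ! i"
    using True by (auto simp: in_set_conv_nth)
  \<comment> \<open>The cyclic predecessor of \<open>i\<close>: the edges at \<open>v\<close> are
    those at positions \<open>i\<close> and \<open>p\<close>.\<close>
  define p where "p = (if i = 0 then length c - 1 else i - 1)"
  have at_v: "v \<in> ?f j \<longleftrightarrow> j = i \<or> j = p" if "j < length c" for j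
  proof -
    have "Suc j mod length c < length c"
      using c(1) by (auto intro!: mod_less_divisor)
    then have "v \<in> ?f j \<longleftrightarrow> i = j \<or> i = Suc j mod length c"
      using c that i by (auto simp: nth_eq_iff_index_eq)
    then show ?thesis
      using that i by (auto simp: mod_Suc p_def split: if_splits)
  qed
  have p: "p < length c" "p \<noteq> i"
    using c i by (auto simp: p_def)
  have "{e \<in> cycle_edges c. v \<in> e} = ?f ` {j. j < length c \<and> v \<in> ?f j}"
    unfolding cycle_edges_def by blast
  also have "{j. j < length c \<and> v \<in> ?f j} = {i, p}"
    using at_v i p by blast
  finally have "{e \<in> cycle_edges c. v \<in> e} = ?f ` {i, p}" .
  moreover have "card (?f ` {i, p}) = 2"
    using inj_on_subset[OF inj_on_cycle_edge[OF c], of "{i, p}"] i p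
    by (subst card_image) auto
  ultimately show ?thesis by simp
qed

text \<open>Vertex \<open>t\<close> of the segment of line \<open>k\<close> that runs from its crossing with line \<open>x\<close> to the next one;
  for \<open>t = 0\<close> this is the crossing itself, which line \<open>x\<close> lists as well.\<close>

definition vertex :: "nat \<Rightarrow> nat \<Rightarrow> nat \<Rightarrow> nat" where
  "vertex k x t = to_nat (if t = 0 then (max k x, min k x, 0) else (k, x, t))"

lemma vertex_eq_iff:
  "vertex k x t = vertex k' x' t' \<longleftrightarrow>
     (k = k' \<and> x = x' \<and> t = t') \<or> (t = 0 \<and> t' = 0 \<and> k = x' \<and> x = k')"
  by (auto simp: vertex_def max_def min_def)

section \<open>The graph of the subdivided arrangement\<close>

locale line_arrangement =
  fixes n :: nat and w :: "nat \<Rightarrow> nat \<Rightarrow> nat"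
  assumes n2: "2 \<le> n" and w3: "3 \<le> w k x"
begin

definition arcs :: "(nat \<times> nat \<times> nat) set" where
  "arcs = {(k, x, t). k < n \<and> x < n \<and> t < w k x}"

fun src :: "nat \<times> nat \<times> nat \<Rightarrow> nat" where
  "src (k, x, t) = vertex k x t"

fun dst :: "nat \<times> nat \<times> nat \<Rightarrow> nat" where
  "dst (k, x, t) = (if Suc t < w k x then vertex k x (Suc t) else vertex k (Suc x mod n) 0)"

definition ends :: "nat \<times> nat \<times> nat \<Rightarrow> nat set" where
  "ends a = {src a, dst a}"

definition verts :: "nat set" where
  "verts = src ` arcs"

definition edges :: "nat set set" where
  "edges = ends ` arcs"

definition prev :: "nat \<Rightarrow> nat" where
  "prev x = (if x = 0 then n - 1 else x - 1)"

lemma prev_less: "x \<le> n \<Longrightarrow> prev x < n"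
  using n2 by (auto simp: prev_def)

lemma prev_Suc [simp]: "prev (Suc x) = x"
  by (simp add: prev_def)

lemma Suc_mod_eq_iff: "x < n \<Longrightarrow> j < n \<Longrightarrow> Suc x mod n = j \<longleftrightarrow> x = prev j"
  using n2 by (auto simp: mod_Suc prev_def)

lemma w_gt [simp]: "0 < w k x" "Suc 0 < w k x" "Suc (Suc 0) < w k x"
  using w3[of k x] by auto

lemma finite_arcs: "finite arcs"
proof -
  have "arcs = Sigma {..<n} (\<lambda>k. Sigma {..<n} (\<lambda>x. {..<w k x}))"
    by (auto simp: arcs_def)
  then show ?thesis by simp
qed

lemma finite_verts: "finite verts"
  by (simp add: verts_def finite_arcs)

lemma dst_in_verts:
  assumes "a \<in> arcs"
  shows "dst a \<in> verts"
proof -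
  obtain k x t where a: "a = (k, x, t)" by (cases a)
  have "dst a = src (if Suc t < w k x then (k, x, Suc t) else (k, Suc x mod n, 0))"
    by (simp add: a)
  moreover have "(if Suc t < w k x then (k, x, Suc t) else (k, Suc x mod n, 0)) \<in> arcs"
    using assms by (auto simp: a arcs_def)
  ultimately show ?thesis by (simp only: verts_def imageI)
qed

lemma src_neq_dst: "a \<in> arcs \<Longrightarrow> src a \<noteq> dst a"
  using w3 n2 by (cases a) (auto simp: arcs_def vertex_eq_iff mod_Suc split: if_splits)

lemma finite_graph_arrangement: "finite_graph verts edges"
proof -
  have "ends a \<subseteq> verts \<and> card (ends a) = 2" if "a \<in> arcs" for a
    using that src_neq_dst[OF that] dst_in_verts[OF that] by (auto simp: ends_def verts_def)
  then show ?thesis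
    by (auto simp: finite_graph_def finite_verts edges_def)
qed

text \<open>Since \<open>w k x\<close> exceeds 1, every arc has an inner vertex of its segment among
  its ends, and this vertex names the line and the segment. So even two lines give no parallel
  edges.\<close>

lemma inj_on_ends: "inj_on ends arcs"
proof (rule inj_onI)
  fix a b assume ab: "a \<in> arcs" "b \<in> arcs" "ends a = ends b"
  obtain k x t where a: "a = (k, x, t)" by (cases a)
  obtain k' x' t' where b: "b = (k', x', t')" by (cases b)
  have "src a = src b \<or> src a = dst b \<and> dst a = src b" "src a = src b \<Longrightarrow> dst a = dst b"
    using ab(3) by (auto simp: ends_def doubleton_eq_iff)
  moreover have "a = b" if "src a = src b" "dst a = dst b"
    using that ab(1,2) by (auto simp: a b vertex_eq_iff split: if_splits)
  moreover have False if "src a = dst b" "dst a = src b"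
    using that w_gt[of k x] by (auto simp: a b vertex_eq_iff split: if_splits)
  ultimately show "a = b" by blast
qed

lemma inner_vertex_in_ends_iff:
  assumes "(k, x, Suc t) \<in> arcs" "a \<in> arcs"
  shows "vertex k x (Suc t) \<in> ends a \<longleftrightarrow> a = (k, x, t) \<or> a = (k, x, Suc t)"
  using assms by (cases a) (auto simp: ends_def arcs_def vertex_eq_iff split: if_splits)

text \<open>Two arcs leave and two arrive, one of each per line. For \<open>i = j\<close>, the
  tangency point, the four collapse to two.\<close>

lemma crossing_in_ends_iff:
  assumes "i < n" "j < n" "a \<in> arcs"
  shows "vertex i j 0 \<in> ends a \<longleftrightarrow>
    a \<in> {(i, j, 0), (j, i, 0), (i, prev j, w i (prev j) - 1), (j, prev i, w j (prev i) - 1)}"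
proof -
  obtain k x t where a: "a = (k, x, t)" by (cases a)
  then have k: "k < n" "x < n" "t < w k x"
    using assms by (auto simp: arcs_def)
  have "vertex i j 0 = src a \<longleftrightarrow> a \<in> {(i, j, 0), (j, i, 0)}"
    by (auto simp: a vertex_eq_iff)
  moreover have "vertex i j 0 = dst a \<longleftrightarrow> a \<in> {(i, prev j, w i (prev j) - 1), (j, prev i, w j (prev i) - 1)}"
    using k Suc_mod_eq_iff[OF k(2), of i] Suc_mod_eq_iff[OF k(2), of j] assms
    by (auto simp: a vertex_eq_iff)
  ultimately show ?thesis by (auto simp: ends_def)
qed

section \<open>Cycles as unions of whole segments\<close>

definition used :: "nat list \<Rightarrow> nat \<times> nat \<times> nat \<Rightarrow> bool" where
  "used c a \<longleftrightarrow> a \<in> arcs \<and> ends a \<in> cycle_edges c"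

lemma even_card_used_at:
  assumes "is_cycle verts edges c"
  shows "even (card {a. used c a \<and> v \<in> ends a})"
proof -
  have "ends ` {a. used c a \<and> v \<in> ends a} = {e \<in> cycle_edges c. v \<in> e}"
    using cycle_edges_subset[OF assms] by (auto simp: used_def edges_def)
  moreover have "inj_on ends {a. used c a \<and> v \<in> ends a}"
    by (rule inj_on_subset[OF inj_on_ends]) (auto simp: used_def)
  ultimately have "card {a. used c a \<and> v \<in> ends a} = card {e \<in> cycle_edges c. v \<in> e}"
    using card_image by fastforce
  then show ?thesis
    using even_card_cycle_edges_at[OF assms, of v] by simp
qed

text \<open>The two arcs are the only ones at an inner vertex, and a cycle uses an even number of
  them.\<close>

lemma used_Suc_iff:
  assumes "is_cycle verts edges c" "(k, x, Suc t) \<in> arcs"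
  shows "used c (k, x, Suc t) \<longleftrightarrow> used c (k, x, t)"
proof (rule ccontr)
  assume neq: "\<not> ?thesis"
  have "{a. used c a \<and> vertex k x (Suc t) \<in> ends a} = {a \<in> {(k, x, t), (k, x, Suc t)}. used c a}"
    using inner_vertex_in_ends_iff[OF assms(2)] by (auto simp: used_def)
  also have "\<dots> = (if used c (k, x, t) then {(k, x, t)} else {(k, x, Suc t)})"
    using neq by auto
  finally show False
    using even_card_used_at[OF assms(1), of "vertex k x (Suc t)"] by (simp split: if_splits)
qed

lemma used_iff:
  assumes "is_cycle verts edges c" "(k, x, t) \<in> arcs"
  shows "used c (k, x, t) \<longleftrightarrow> used c (k, x, 0)"
  using assms(2)
proof (induction t)
  case (Suc t)
  then show ?case
    using used_Suc_iff[OF assms(1), of k x t] by (auto simp: arcs_def)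
qed simp

text \<open>Cycles contain segments entirely or not at all, so cycle lengths become subset sums of
  the weights \<open>w k x\<close>.\<close>

lemma length_cycle:
  assumes "is_cycle verts edges c"
  shows "length c = (\<Sum>(k, x) | used c (k, x, 0). w k x)"
proof -
  let ?Q = "{(k, x). used c (k, x, 0)}"
  have "cycle_edges c = ends ` {a. used c a}"
    using cycle_edges_subset[OF assms] by (auto simp: used_def edges_def)
  moreover have "inj_on ends {a. used c a}"
    by (rule inj_on_subset[OF inj_on_ends]) (auto simp: used_def)
  ultimately have "length c = card {a. used c a}"
    using card_cycle_edges[OF assms] by (simp add: card_image)
  also have "{a. used c a} = (\<lambda>((k, x), t). (k, x, t)) ` Sigma ?Q (\<lambda>(k, x). {..<w k x})"
  proof (intro set_eqI iffI)
    fix a assume a: "a \<in> {a. used c a}"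
    obtain k x t where kxt: "a = (k, x, t)" by (cases a)
    then have "t < w k x" "used c (k, x, 0)"
      using a used_iff[OF assms, of k x t] by (auto simp: used_def arcs_def)
    then show "a \<in> (\<lambda>((k, x), t). (k, x, t)) ` Sigma ?Q (\<lambda>(k, x). {..<w k x})"
      by (intro image_eqI[where x = "((k, x), t)"]) (auto simp: kxt)
  next
    fix a assume "a \<in> (\<lambda>((k, x), t). (k, x, t)) ` Sigma ?Q (\<lambda>(k, x). {..<w k x})"
    then obtain k x t where kxt: "a = (k, x, t)" "used c (k, x, 0)" "t < w k x"
      by auto
    moreover have "(k, x, t) \<in> arcs"
      using kxt by (auto simp: used_def arcs_def)
    ultimately show "a \<in> {a. used c a}"
      using used_iff[OF assms] by simp
  qed
  also have "card \<dots> = card (Sigma ?Q (\<lambda>(k, x). {..<w k x}))"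
    by (rule card_image) (auto simp: inj_on_def)
  also have "\<dots> = (\<Sum>(k, x)\<in>?Q. w k x)"
  proof (subst card_SigmaI)
    have "?Q \<subseteq> {..<n} \<times> {..<n}"
      by (auto simp: used_def arcs_def)
    then show "finite ?Q"
      by (rule finite_subset) simp
  qed (auto simp: case_prod_beta)
  finally show ?thesis .
qed

text \<open>Cell \<open>x\<close> is the segment that arrives at crossing \<open>x\<close>. With
  \<open>prev\<close>, cells \<open>0\<close> and \<open>n\<close> both become segment
  \<open>n - 1\<close>, the one through infinity.\<close>

definition cell_bit :: "nat list \<Rightarrow> nat \<Rightarrow> nat \<Rightarrow> bit" where
  "cell_bit c k x = of_bool (used c (k, prev x, 0))"

lemma mod2_cycle_cell_bit:
  assumes "is_cycle verts edges c"
  shows "mod2_cycle n (cell_bit c)"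
proof -
  have last: "used c (k, x, w k x - 1) \<longleftrightarrow> used c (k, x, 0)" if "k < n" "x < n" for k x
    by (rule used_iff[OF assms]) (use that in \<open>auto simp: arcs_def\<close>)
  have even: "even (card {a \<in> {(i, j, 0), (j, i, 0), (i, prev j, w i (prev j) - 1),
      (j, prev i, w j (prev i) - 1)}. used c a})" (is "even (card {a \<in> ?F i j. _})")
    if "i < n" "j < n" for i j
  proof -
    have "{a. used c a \<and> vertex i j 0 \<in> ends a} = {a \<in> ?F i j. used c a}"
      using crossing_in_ends_iff[OF that] by (auto simp only: used_def)
    then show ?thesis
      using even_card_used_at[OF assms, of "vertex i j 0"] by simp
  qed
  have bit: "(\<Sum>a\<in>F. of_bool (used c a) :: bit) = 0"
    if "finite F" "even (card {a \<in> F. used c a})" for F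
    using that by (auto simp: sum.If_cases of_bool_def Int_def elim!: evenE)
  have w1: "w k x - 1 \<noteq> 0" for k x
    using w_gt(2)[of k x] by linarith
  have "cell_bit c i i = cell_bit c i (Suc i)" if "i < n" for i
  proof -
    \<comment> \<open>At the tangency point evenness over two arcs says that both or neither are
      used.\<close>
    have "?F i i = {(i, i, 0), (i, prev i, w i (prev i) - 1)}" by auto
    then have "(\<Sum>a\<in>{(i, i, 0), (i, prev i, w i (prev i) - 1)}. of_bool (used c a) :: bit) = 0"
      using bit[OF _ even[OF that that]] by simp
    then show ?thesis
      using that last[OF that prev_less[of i]] w1[of i "prev i"]
      by (simp add: cell_bit_def bit_add_eq_0_iff del: sum_of_bool_eq)
  qed
  moreover have "cell_bit c i j + cell_bit c i (Suc j) = cell_bit c j i + cell_bit c j (Suc i)"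
    if "i < n" "j < n" for i j
  proof (cases "i = j")
    case False
    have "(\<Sum>a\<in>?F i j. of_bool (used c a) :: bit) = 0"
      using even[OF that] by (intro bit) auto
    then show ?thesis
      using False that last[of i "prev j"] last[of j "prev i"] prev_less[of i] prev_less[of j]
        w1[of i "prev j"] w1[of j "prev i"] that
      by (simp add: cell_bit_def bit_add_eq_0_iff add_ac del: sum_of_bool_eq)
  qed simp
  moreover have "cell_bit c i 0 = cell_bit c i n" for i
    using n2 by (simp add: cell_bit_def prev_def)
  ultimately show ?thesis
    by (simp add: mod2_cycle_def)
qed

lemma crossing_in_cycle:
  assumes "is_cycle verts edges c" "i < n" "j < n" "cell_bit c i j \<noteq> 0 \<or> cell_bit c i (Suc j) \<noteq> 0"
  shows "vertex i j 0 \<in> set c"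
proof -
  have "used c (i, prev j, 0) \<or> used c (i, j, 0)"
    using assms(4) by (auto simp: cell_bit_def)
  then have "used c (i, prev j, w i (prev j) - 1) \<or> used c (i, j, 0)"
    using used_iff[OF assms(1), of i "prev j" "w i (prev j) - 1"] assms(2,3) prev_less[of j]
    by (auto simp: arcs_def)
  then obtain a where "used c a" "vertex i j 0 \<in> ends a"
    using crossing_in_ends_iff[OF assms(2,3)] unfolding used_def by blast
  then show ?thesis
    using cycle_edge_vertices by (auto simp: used_def)
qed

lemma one_sided_cycles_intersect:
  assumes "is_cycle verts edges c" "is_cycle verts edges d"
    and "card {k. used c (k, n - 1, 0)} = 1" "card {k. used d (k, n - 1, 0)} = 1"
  shows "set c \<inter> set d \<noteq> {}"
proof -
  have "(\<Sum>k<n. cell_bit c k 0) = 1" if "card {k. used c (k, n - 1, 0)} = 1" for c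
  proof -
    have "{k. used c (k, n - 1, 0)} = {k. k < n \<and> used c (k, n - 1, 0)}"
      by (auto simp: used_def arcs_def)
    then show ?thesis
      using that n2 by (simp add: cell_bit_def prev_def of_bool_def sum.If_cases Int_def)
  qed
  then obtain i j where ij: "i < n" "j < n" "cell_bit d i j \<noteq> 0 \<or> cell_bit d i (Suc j) \<noteq> 0"
    "cell_bit c i j \<noteq> 0 \<or> cell_bit c i (Suc j) \<noteq> 0 \<or> cell_bit c j i \<noteq> 0 \<or> cell_bit c j (Suc i) \<noteq> 0"
    using one_sided_cycles_meet[of n "cell_bit c" "cell_bit d"] mod2_cycle_cell_bit assms by blast
  have "vertex i j 0 = vertex j i 0"
    by (simp add: vertex_eq_iff)
  then have "vertex i j 0 \<in> set c \<inter> set d"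
    using crossing_in_cycle[OF assms(2) ij(1,2)] crossing_in_cycle[OF assms(1) ij(1,2)]
      crossing_in_cycle[OF assms(1) ij(2,1)] ij(3,4) by auto
  then show ?thesis by blast
qed

section \<open>The lines as cycles, and their survival under deletions\<close>

definition segment :: "nat \<Rightarrow> nat \<Rightarrow> nat list" where
  "segment k x = map (\<lambda>t. vertex k x t) [0..<w k x]"

definition line :: "nat \<Rightarrow> nat list" where
  "line k = concat (map (segment k) [0..<n])"

lemma set_segments: "set (concat (map (segment k) [0..<m])) = {vertex k x t |x t. x < m \<and> t < w k x}"
  by (auto simp: segment_def) blast

lemma set_line: "set (line k) = {vertex k x t |x t. x < n \<and> t < w k x}"
  by (simp only: line_def set_segments)

lemma length_line: "length (line k) = (\<Sum>x<n. w k x)"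
proof -
  have "length (concat (map (segment k) [0..<m])) = (\<Sum>x<m. w k x)" for m
    by (induction m) (simp_all add: segment_def)
  then show ?thesis by (simp add: line_def)
qed

lemma distinct_line: "distinct (line k)"
proof -
  have "distinct (concat (map (segment k) [0..<m]))" for m
  proof (induction m)
    case (Suc m)
    have "distinct (segment k m)"
      by (auto simp: segment_def distinct_map inj_on_def vertex_eq_iff)
    moreover have "set (concat (map (segment k) [0..<m])) \<inter> set (segment k m) = {}"
      unfolding set_segments by (auto simp: segment_def vertex_eq_iff)
    ultimately show ?case
      using Suc by simp
  qed simp
  then show ?thesis by (simp add: line_def)
qed

lemma line_adjacent:
  assumes "k < n" "i < length (line k)"
  shows "\<exists>a\<in>arcs. line k ! i = src a \<and> line k ! (Suc i mod length (line k)) = dst a"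
proof -
  define R where "R u v \<longleftrightarrow> (\<exists>x<n. \<exists>t<w k x. u = vertex k x t \<and> v = dst (k, x, t))" for u v
  have w0: "segment k x \<noteq> []" for x
    using w_gt(1)[of k x] by (auto simp: segment_def)
  have hd: "hd (segment k x) = vertex k x 0" for x
    using w0[of x] by (auto simp: segment_def hd_map)
  have last: "last (segment k x) = vertex k x (w k x - 1)" for x
    using w0[of x] by (auto simp: segment_def last_map)
  have seg: "successively R (segment k x)" if "x < n" for x
    unfolding successively_conv_nth using that by (auto simp: segment_def R_def)
  have joint: "R (vertex k x (w k x - 1)) (vertex k (Suc x mod n) 0)" if "x < n" for x
    using that unfolding R_def
    by (intro exI[of _ x] conjI exI[of _ "w k x - 1"]) simp_all
  \<comment> \<open>First and last vertices are carried along so that the next segment can be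
    attached and the line closed at the end.\<close>
  have "successively R (concat (map (segment k) [0..<m])) \<and>
      (0 < m \<longrightarrow> concat (map (segment k) [0..<m]) \<noteq> [] \<and>
         hd (concat (map (segment k) [0..<m])) = vertex k 0 0 \<and>
         last (concat (map (segment k) [0..<m])) = vertex k (m - 1) (w k (m - 1) - 1))" if "m \<le> n" for m
    using that
  proof (induction m)
    case (Suc m)
    then show ?case
      using seg[of m] joint[of "m - 1"] w0[of m] hd[of m] last[of m]
      by (cases "m = 0") (auto simp: successively_append_iff hd_append last_append)
  qed simp
  from this[of n] n2 have line: "successively R (line k)" "line k \<noteq> []"
    "hd (line k) = vertex k 0 0" "last (line k) = vertex k (n - 1) (w k (n - 1) - 1)"
    by (simp_all add: line_def)
  have "R (line k ! i) (line k ! (Suc i mod length (line k)))"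
  proof (cases "Suc i = length (line k)")
    case True
    have "R (last (line k)) (hd (line k))"
      using joint[of "n - 1"] n2 line by simp
    moreover have "i = length (line k) - 1"
      using True by simp
    ultimately show ?thesis
      using line(2) True by (simp add: hd_conv_nth last_conv_nth)
  next
    case False
    then show ?thesis
      using assms line(1) by (simp add: successively_conv_nth)
  qed
  then obtain x t where "x < n" "t < w k x" "line k ! i = vertex k x t"
      "line k ! (Suc i mod length (line k)) = dst (k, x, t)"
    by (auto simp: R_def simp del: dst.simps)
  then show ?thesis
    using assms(1) by (intro bexI[of _ "(k, x, t)"]) (simp_all add: arcs_def del: dst.simps)
qed

lemma line_is_cycle:
  assumes "k < n" "set (line k) \<inter> X = {}"
  shows "is_cycle (verts - X) (delete_edges edges X) (line k)"
  unfolding is_cycle_def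
proof (intro conjI allI impI)
  have "3 \<le> w k 0"
    by (rule w3)
  also have "w k 0 \<le> (\<Sum>x<n. w k x)"
    using n2 by (intro member_le_sum) auto
  finally show "3 \<le> length (line k)"
    by (simp add: length_line)
  show "distinct (line k)"
    by (rule distinct_line)
  have "set (line k) \<subseteq> verts"
    using assms(1) by (force simp: set_line verts_def arcs_def)
  then show "set (line k) \<subseteq> verts - X"
    using assms(2) by blast
  fix i assume i: "i < length (line k)"
  then obtain a where a: "a \<in> arcs" "line k ! i = src a" "line k ! (Suc i mod length (line k)) = dst a"
    using line_adjacent[OF assms(1)] by blast
  have "{line k ! i, line k ! (Suc i mod length (line k))} \<subseteq> set (line k)"
    using i by (auto intro!: nth_mem mod_less_divisor)
  then have "ends a \<inter> X = {}"
    using assms(2) a by (auto simp: ends_def)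
  then show "{line k ! i, line k ! (Suc i mod length (line k))} \<in> delete_edges edges X"
    using a by (auto simp: delete_edges_def edges_def ends_def)
qed

text \<open>A crossing lies on the two lines that define it, any other vertex on one.\<close>

lemma card_lines_through: "card {k. k < n \<and> v \<in> set (line k)} \<le> 2"
proof (cases "\<exists>k<n. v \<in> set (line k)")
  case True
  then obtain k x t where "v = vertex k x t"
    by (auto simp: set_line)
  then have "{k. k < n \<and> v \<in> set (line k)} \<subseteq> {k, x}"
    by (auto simp: set_line vertex_eq_iff)
  then have "card {k. k < n \<and> v \<in> set (line k)} \<le> card {k, x}"
    by (intro card_mono) auto
  also have "\<dots> \<le> 2"
    by (simp add: card_insert_if)
  finally show ?thesis .
qed (simp cong: conj_cong)

lemma card_surviving_lines:
  assumes "finite X"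
  shows "n \<le> card {k. k < n \<and> set (line k) \<inter> X = {}} + 2 * card X"
proof -
  have "card (\<Union>v\<in>X. {k. k < n \<and> v \<in> set (line k)}) \<le> (\<Sum>v\<in>X. card {k. k < n \<and> v \<in> set (line k)})"
    by (rule card_UN_le[OF assms])
  also have "\<dots> \<le> (\<Sum>v\<in>X. 2)"
    by (intro sum_mono card_lines_through)
  finally have "card (\<Union>v\<in>X. {k. k < n \<and> v \<in> set (line k)}) \<le> 2 * card X"
    by simp
  moreover have "{..<n} = {k. k < n \<and> set (line k) \<inter> X = {}} \<union> (\<Union>v\<in>X. {k. k < n \<and> v \<in> set (line k)})"
    by blast
  then have "card {..<n} \<le> card {k. k < n \<and> set (line k) \<inter> X = {}} + card (\<Union>v\<in>X. {k. k < n \<and> v \<in> set (line k)})"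
    by (simp only: card_Un_le)
  ultimately show ?thesis by simp
qed

section \<open>Drawing the arrangement in the projective plane\<close>

definition place :: "nat \<Rightarrow> (real ^ 3) set" where
  "place v = (let (k, x, t) = from_nat v :: nat \<times> nat \<times> nat in pt n k (real x + real t / w k x))"

fun draw :: "nat \<times> nat \<times> nat \<Rightarrow> real \<Rightarrow> (real ^ 3) set" where
  "draw (k, x, t) s = pt n k (real x + real t / w k x + s * (1 / w k x))"

lemma place_vertex [simp]: "place (vertex k x t) = pt n k (real x + real t / w k x)"
proof (cases "t = 0")
  case True
  have "pt n (real (max k x)) (real (min k x)) = pt n (real k) (real x)"
    by (cases "k \<le> x") (simp_all add: pt_commute[of n x] max_def min_def)
  then show ?thesis
    using True by (simp add: place_def vertex_def)
qed (simp add: place_def vertex_def)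

text \<open>The last segment ends at parameter \<open>n\<close>, which by \<open>pt_periodic\<close>
  is the crossing with parameter \<open>0\<close>.\<close>

lemma place_dst:
  assumes "x < n" "t < w k x"
  shows "place (dst (k, x, t)) = pt n k (real x + (real t + 1) / w k x)"
proof (cases "Suc t < w k x")
  case False
  then have w: "real (w k x) = t + 1"
    using assms by simp
  have "pt n k (real (Suc x mod n)) = pt n k (x + 1)"
    using assms(1) pt_periodic[of n k 0] by (cases "Suc x = n") (auto simp: add.commute)
  then show ?thesis
    using False w by (simp add: add.commute)
qed (simp add: add.commute)

lemma draw_param:
  assumes "t < w k x" "0 < s" "s < (1::real)"
  shows "real x < real x + real t / w k x + s * (1 / w k x)" "real x + real t / w k x + s * (1 / w k x) < real x + 1"
proof -
  have "0 < real t + s" "real t + s < w k x"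
    using assms by linarith+
  then have "0 < (t + s) / w k x" "(t + s) / w k x < 1"
    by (simp_all add: divide_less_eq)
  then show "real x < real x + real t / w k x + s * (1 / w k x)" "real x + real t / w k x + s * (1 / w k x) < real x + 1"
    by (simp_all add: add_divide_distrib)
qed

lemma draw_param_closed:
  assumes "t < w k x" "0 \<le> s" "s \<le> (1::real)"
  shows "real x \<le> real x + real t / w k x + s * (1 / w k x)" "real x + real t / w k x + s * (1 / w k x) \<le> real x + 1"
proof -
  have "0 \<le> real t + s" "real t + s \<le> w k x"
    using assms by linarith+
  then have "0 \<le> (t + s) / w k x" "(t + s) / w k x \<le> 1"
    by (simp_all add: divide_le_eq)
  then show "real x \<le> real x + real t / w k x + s * (1 / w k x)" "real x + real t / w k x + s * (1 / w k x) \<le> real x + 1"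
    by (simp_all add: add_divide_distrib)
qed

text \<open>The swapped alternative of \<open>pt_eqD\<close> would make \<open>b\<close> the integer
  \<open>k'\<close>, but \<open>b\<close> lies strictly between integers. The closed end
  \<open>b' = n\<close> is read as \<open>0\<close>, again an integer.\<close>

lemma pt_eq_interiorD:
  fixes k k' x :: nat and b b' :: real
  assumes "pt n k b = pt n k' b'" "k < n" "k' < n" "x < n" "real x < b" "b < real x + 1"
    "0 \<le> b'" "b' \<le> n"
  shows "k = k'" "b = b'"
proof -
  have b: "0 \<le> b" "b < n" "b \<noteq> real m" for m
    using assms by (auto simp flip: of_nat_Suc)
  have "k = k' \<and> b = b'"
  proof (cases "b' < n")
    case True
    then show ?thesis
      using pt_eqD[OF assms(1)] assms b by auto
  next
    case False
    then have "b' = 0 + real n"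
      using assms by simp
    then have "pt n k b = pt n k' 0"
      using assms(1) pt_periodic[of n k' 0] n2 by simp
    then show ?thesis
      using pt_eqD[of n k b k' 0] assms b(1,2) b(3)[of 0] b(3)[of k'] by auto
  qed
  then show "k = k'" "b = b'" by auto
qed

lemma nat_add_fraction_eq:
  fixes r s :: real
  assumes "real x + r = real y + s" "0 \<le> r" "r < 1" "0 \<le> s" "s < 1"
  shows "x = y \<and> r = s"
proof -
  have "x = y"
    using assms by linarith
  with assms show ?thesis by simp
qed

lemma inj_on_place: "inj_on place verts"
proof (rule inj_onI)
  fix u v assume "u \<in> verts" "v \<in> verts" and eq: "place u = place v"
  then obtain k x t k' x' t' where u: "u = vertex k x t" "k < n" "x < n" "t < w k x"
    and v: "v = vertex k' x' t'" "k' < n" "x' < n" "t' < w k' x'"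
    by (auto simp: verts_def arcs_def)
  have frac: "0 \<le> t / w k x" "t / w k x < 1" "0 \<le> t' / w k' x'" "t' / w k' x' < 1"
    using u v by auto
  moreover have "real x + real t / w k x < n" "real x' + real t' / w k' x' < n"
    using frac u v by linarith+
  ultimately consider "k = k'" "real x + real t / w k x = real x' + real t' / w k' x'"
    | "real x + real t / w k x = real k' + 0" "real x' + real t' / w k' x' = real k + 0"
    using pt_eqD[of n k "real x + real t / w k x" k' "real x' + real t' / w k' x'"] eq u v by force
  then show "u = v"
  proof cases
    case 1
    then have "x = x'" "t / w k x = t' / w k' x'"
      using nat_add_fraction_eq frac by blast+
    then show ?thesis
      using 1 u v by auto
  next
    \<comment> \<open>Both parameters are integers, so \<open>u\<close> and \<open>v\<close> are one
      crossing, seen from its two lines.\<close>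
    case 2
    then have "x = k' \<and> t / w k x = 0" "x' = k \<and> t' / w k' x' = 0"
      using frac by (intro nat_add_fraction_eq; simp)+
    then show ?thesis
      using u v by (auto simp: vertex_eq_iff)
  qed
qed

lemma inj_on_draw:
  assumes "a \<in> arcs"
  shows "inj_on (draw a) {0..1}"
proof (rule inj_onI)
  obtain k x t where a: "a = (k, x, t)" by (cases a)
  then have k: "k < n" "x < n" "t < w k x"
    using assms by (auto simp: arcs_def)
  fix s s' :: real assume s: "s \<in> {0..1}" "s' \<in> {0..1}" and eq: "draw a s = draw a s'"
  let ?b = "\<lambda>s. real x + real t / w k x + s * (1 / w k x)"
  have b: "real x \<le> ?b s" "?b s \<le> real x + 1" "real x \<le> ?b s'" "?b s' \<le> real x + 1"
    using draw_param_closed[of t k x] k s by auto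
  have xn: "real x + 1 \<le> n"
    using k by linarith
  have wrap: "pt n k (real n) = pt n k 0"
    using pt_periodic[of n k 0] n2 by simp
  \<comment> \<open>Only \<open>b' = n\<close> escapes \<open>pt_eqD\<close>. It is the same point
    as \<open>0\<close>, but the segment ending there begins at \<open>n - 1 > 0\<close>.\<close>
  have *: "b = b'" if "pt n k b = pt n k b'" "real x \<le> b" "b < n" "real x \<le> b'" "b' \<le> real x + 1" for b b'
  proof (cases "b' < n")
    case True
    then show ?thesis using pt_eqD[OF that(1)] that k by auto
  next
    case False
    then have "b' = n" "x + 1 = n"
      using that xn by linarith+
    then show ?thesis
      using pt_eqD[of n k b k 0] that k n2 wrap by auto
  qed
  have eq': "pt n k (?b s) = pt n k (?b s')"
    using eq by (simp only: a draw.simps)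
  consider "?b s < n" | "?b s' < n" | "?b s = n" "?b s' = n"
    using b xn by linarith
  then have "?b s = ?b s'"
  proof cases
    case 1
    with eq' b show ?thesis by (intro *)
  next
    case 2
    with eq' b show ?thesis by (intro *[symmetric]) simp_all
  qed simp
  then show "s = s'"
    using k by simp
qed

lemma draw_ends:
  assumes "a \<in> arcs"
  shows "{draw a 0, draw a 1} = place ` ends a"
  using assms place_dst by (cases a) (auto simp: ends_def arcs_def add_divide_distrib add.assoc simp del: dst.simps)

lemma draw_interior_disjoint_verts:
  assumes "a \<in> arcs" "s \<in> {0<..<1}"
  shows "draw a s \<notin> place ` verts"
proof
  obtain k x t where a: "a = (k, x, t)" by (cases a)
  then have k: "k < n" "x < n" "t < w k x"
    using assms by (auto simp: arcs_def)
  assume "draw a s \<in> place ` verts"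
  then obtain k' x' t' where v: "draw a s = pt n k' (real x' + real t' / w k' x')" "k' < n" "x' < n" "t' < w k' x'"
    by (auto simp: verts_def arcs_def)
  have frac: "0 \<le> t' / w k' x'" "t' / w k' x' < 1"
    using v by auto
  then have b': "0 \<le> real x' + real t' / w k' x'" "real x' + real t' / w k' x' \<le> n"
    using v by linarith+
  have b: "real x < real x + real t / w k x + s * (1 / w k x)"
    "real x + real t / w k x + s * (1 / w k x) < real x + 1"
    using draw_param[of t k x s] k assms(2) by auto
  have eq: "k = k'" "real x + real t / w k x + s * (1 / w k x) = real x' + real t' / w k' x'"
    using pt_eq_interiorD[OF v(1)[unfolded a draw.simps] k(1) v(2) k(2) b b'] by blast+
  then have "x = x' \<and> t / w k x + s * (1 / w k x) = t' / w k' x'"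
    using draw_param[of t k x s] k assms(2) frac by (intro nat_add_fraction_eq) auto
  then have "(t + s) / w k x = t' / w k x"
    using eq by (simp add: add_divide_distrib)
  then have "real t + s = real t'"
    using k by simp
  then have "t < t'" "t' < t + 1"
    using assms(2) by auto
  then show False by simp
qed

lemma draw_interiors_disjoint:
  assumes "a \<in> arcs" "a' \<in> arcs" "s \<in> {0<..<1}" "s' \<in> {0..1}" "draw a s = draw a' s'"
  shows "a = a'"
proof -
  obtain k x t where a: "a = (k, x, t)" by (cases a)
  obtain k' x' t' where a': "a' = (k', x', t')" by (cases a')
  have k: "k < n" "x < n" "t < w k x" "k' < n" "x' < n" "t' < w k' x'"
    using assms by (auto simp: arcs_def a a')
  have b: "real x < real x + real t / w k x + s * (1 / w k x)"
    "real x + real t / w k x + s * (1 / w k x) < real x + 1"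
    using draw_param[of t k x s] k assms(3) by auto
  have b'_cell: "real x' \<le> real x' + real t' / w k' x' + s' * (1 / w k' x')"
    "real x' + real t' / w k' x' + s' * (1 / w k' x') \<le> real x' + 1"
    using draw_param_closed[of t' k' x' s'] k assms(4) by auto
  then have b': "0 \<le> real x' + real t' / w k' x' + s' * (1 / w k' x')"
    "real x' + real t' / w k' x' + s' * (1 / w k' x') \<le> n"
    using k by linarith+
  have eq: "k = k' \<and> real x + real t / w k x + s * (1 / w k x) = real x' + real t' / w k' x' + s' * (1 / w k' x')"
    using pt_eq_interiorD[OF assms(5)[unfolded a a' draw.simps] k(1) k(4) k(2) b b'] by blast
  have "real x < real x' + 1" "real x' < real x + 1"
    using eq b b'_cell by linarith+
  then have "x = x'" by linarith
  with eq have "k = k'" "(t + s) / w k x = (t' + s') / w k x"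
    by (auto simp: add_divide_distrib)
  then have "t + s = t' + s'"
    using k by simp
  \<comment> \<open>\<open>s' - s\<close> lies strictly between -1 and 1.\<close>
  then have "t = t'"
    using assms(3,4) by simp
  with \<open>k = k'\<close> \<open>x = x'\<close> show ?thesis by (simp add: a a')
qed

lemma projective_planar_arrangement: "projective_planar verts edges"
proof -
  define \<gamma> where "\<gamma> e = draw (the_inv_into arcs ends e)" for e
  have \<gamma>: "\<gamma> (ends a) = draw a" if "a \<in> arcs" for a
    using that by (simp add: \<gamma>_def the_inv_into_f_f inj_on_ends)
  have path: "pathin projective_plane (draw a)" for a
  proof -
    obtain k x t where "a = (k, x, t)" by (cases a)
    then have "draw a = (\<lambda>s. pt n k (real x + real t / w k x + s * (1 / w k x)))"
      by (simp add: fun_eq_iff)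
    then show ?thesis
      using n2 by (simp only: pathin_pt)
  qed
  have "graph_embedding projective_plane verts edges place \<gamma>"
    unfolding graph_embedding_def
  proof (intro conjI ballI impI)
    show "place ` verts \<subseteq> topspace projective_plane"
      by (auto simp: verts_def arcs_def pt_in_topspace)
    show "inj_on place verts"
      by (rule inj_on_place)
    fix e assume "e \<in> edges"
    then obtain a where a: "a \<in> arcs" "e = ends a"
      by (auto simp: edges_def)
    show "pathin projective_plane (\<gamma> e)" "inj_on (\<gamma> e) {0..1}" "{\<gamma> e 0, \<gamma> e 1} = place ` e"
      using a path inj_on_draw draw_ends by (simp_all add: \<gamma>)
    show "\<gamma> e ` {0<..<1} \<inter> place ` verts = {}"
      unfolding a(2) \<gamma>[OF a(1)] using draw_interior_disjoint_verts[OF a(1)] by blast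
    fix f assume "f \<in> edges" "e \<noteq> f"
    then obtain a' where a': "a' \<in> arcs" "f = ends a'" "a \<noteq> a'"
      using a by (auto simp: edges_def)
    then show "\<gamma> e ` {0<..<1} \<inter> \<gamma> f ` {0..1} = {}"
      unfolding a(2) a'(2) \<gamma>[OF a(1)] \<gamma>[OF a'(1)]
      using draw_interiors_disjoint[OF a(1) a'(1)] by blast
  qed
  then show ?thesis
    by (auto simp: projective_planar_def)
qed

end

section \<open>Lengths in gaps of a porous set\<close>

text \<open>Take a long gap beyond some large element of \<open>L\<close>; the last element of
  \<open>L\<close> before this gap is the witness.\<close>

lemma porous_gap_after:
  assumes "infinite L" "porous L"
  obtains a where "a \<in> L" "M \<le> a" "{a<..a + N} \<inter> L = {}"
proof -
  obtain b where b: "b \<in> L" "M \<le> b"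
    using assms(1) by (meson infinite_nat_iff_unbounded_le)
  \<comment> \<open>This gap is so long that it would contain \<open>b\<close> if it started at or
    below \<open>b\<close>.\<close>
  obtain m where "{m..<m + (b + N + 1)} \<subseteq> {1..} - L"
    using assms(2) unfolding porous_def by (metis le_add2)
  then have gap: "i \<notin> L" if "m \<le> i" "i \<le> m + b + N" for i
    using that by fastforce
  then have "b < m"
    using b by (metis add.commute le_add1 not_le trans_le_add1 add.assoc)
  define a where "a = Max (L \<inter> {..<m})"
  have a: "a \<in> L \<inter> {..<m}"
    unfolding a_def using b \<open>b < m\<close> by (intro Max_in) auto
  have "b \<le> a"
    unfolding a_def using b \<open>b < m\<close> by (intro Max_ge) auto
  moreover have "i \<notin> L" if "a < i" "i \<le> a + N" for i
  proof (cases "i < m")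
    case True
    have "i \<in> L \<inter> {..<m} \<Longrightarrow> i \<le> a"
      unfolding a_def by (intro Max_ge) auto
    then show ?thesis
      using True that by auto
  next
    case False
    then show ?thesis
      using that a by (intro gap) auto
  qed
  then have "{a<..a + N} \<inter> L = {}" by auto
  ultimately show ?thesis
    using a b that[of a] by simp
qed

text \<open>Recursion in which the past enters only through its sum, accumulated in
  \<open>S\<close>.\<close>

lemma dependent_sequence:
  assumes "\<And>q s. \<exists>v. P q s v"
  obtains u :: "nat \<Rightarrow> nat" where "\<And>q. P q (\<Sum>p<q. u p) (u q)"
proof -
  obtain f where f: "P q s (f q s)" for q and s :: nat
    using assms by metis
  define S where "S = rec_nat 0 (\<lambda>q s. s + f q s)"
  have "(\<Sum>p<q. f p (S p)) = S q" for q
    by (induction q) (simp_all add: S_def)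
  then show ?thesis
    using f that[of "\<lambda>q. f q (S q)"] by simp
qed

text \<open>Confines a subset sum to a window fixed by its largest index; applied to the weights
  \<open>u\<close> and to the weights \<open>W\<close>.\<close>

lemma sum_between_Max:
  fixes u :: "nat \<Rightarrow> nat"
  assumes "finite Q" "Q \<noteq> {}"
  obtains q where "q \<in> Q" "u q \<le> sum u Q" "sum u Q \<le> u q + (\<Sum>p<q. u p)"
proof
  define q where "q = Max Q"
  show "q \<in> Q"
    unfolding q_def using assms by simp
  then show "u q \<le> sum u Q"
    using assms by (intro member_le_sum) auto
  have "Q \<subseteq> {..q}"
    using assms by (auto simp: q_def)
  then have "sum u Q \<le> sum u {..q}"
    by (intro sum_mono2) auto
  also have "\<dots> = u q + (\<Sum>p<q. u p)"
    by (simp add: lessThan_Suc_atMost[symmetric])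
  finally show "sum u Q \<le> u q + (\<Sum>p<q. u p)" .
qed

text \<open>Guards against \<open>card\<close> being 0 on infinite sets when lengths are
  counted.\<close>

lemma finite_L_cycle_lengths:
  assumes "finite V"
  shows "finite {length c |c. L_cycle L V E c}"
proof (rule finite_subset)
  show "{length c |c. L_cycle L V E c} \<subseteq> {..card V}"
    using assms by (auto simp: L_cycle_def is_cycle_def card_mono simp flip: distinct_card)
qed simp

theorem theorem3p2:
  fixes L :: "nat set" and l :: nat
  assumes "L \<subseteq> {1..}" and "infinite L" and "porous L" and "l \<ge> 1"
  shows "\<exists>(V :: nat set) E. finite_graph V E \<and> projective_planar V E \<and>
           (\<nexists>c d. L_cycle L V E c \<and> L_cycle L V E d \<and> set c \<inter> set d = {}) \<and>
           (\<forall>X. X \<subseteq> V \<and> card X \<le> l \<longrightarrow>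
              card {length c |c. L_cycle L (V - X) (delete_edges E X) c} \<ge> l)"
proof -
  obtain u :: "nat \<Rightarrow> nat" where u: "3 \<le> u q" "{u q..u q + (\<Sum>p<q. u p)} \<inter> L = {}" for q
  proof (rule dependent_sequence[of "\<lambda>q s v. 3 \<le> v \<and> {v..v + s} \<inter> L = {}"])
    fix s
    obtain a where "a \<in> L" "3 \<le> a" "{a<..a + (s + 1)} \<inter> L = {}"
      using porous_gap_after[OF assms(2,3)] .
    then show "\<exists>v\<ge>3. {v..v + s} \<inter> L = {}"
      by (intro exI[of _ "a + 1"]) (auto simp: disjoint_iff)
  qed blast
  define n where "n = 3 * l"
  \<comment> \<open>\<open>x * n + k\<close> ranks the finite segments injectively; division by
    \<open>n\<close> recovers \<open>x\<close> and \<open>k\<close>.\<close>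
  define r where "r k = (\<Sum>x<n - 1. u (x * n + k))" for k
  define S where "S = (\<Sum>k<n. r k)"
  have r_le: "r k \<le> S" if "k < n" for k
    unfolding S_def using that by (intro member_le_sum) auto
  \<comment> \<open>\<open>W k + r k\<close> is the length of line \<open>k\<close>. If
    \<open>k\<close> is the largest index of a segment at infinity on a cycle, its length is at most
    \<open>W k + S + (\<Sum>j<k. W j)\<close>, so the gap leaves only lengths up to that of line
    \<open>k\<close>.\<close>
  obtain W :: "nat \<Rightarrow> nat" where W: "3 \<le> W k" "S + (\<Sum>j<k. W j) < W k" "W k + r k \<in> L"
    "{W k + r k<..W k + S + (\<Sum>j<k. W j)} \<inter> L = {}" for k
  proof (rule dependent_sequence[of "\<lambda>k s v. 3 \<le> v \<and> S + s < v \<and> v + r k \<in> L \<and>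
        {v + r k<..v + S + s} \<inter> L = {}"])
    fix k s
    \<comment> \<open>The lower bound on \<open>a\<close> makes the witness \<open>a - r k\<close>
      at least 3 and larger than \<open>S + s\<close>.\<close>
    obtain a where a: "a \<in> L" "S + s + r k + 3 \<le> a" "{a<..a + (S + s)} \<inter> L = {}"
      using porous_gap_after[OF assms(2,3)] .
    then have "{a<..a - r k + S + s} \<inter> L = {}"
      by fastforce
    with a show "\<exists>v\<ge>3. S + s < v \<and> v + r k \<in> L \<and> {v + r k<..v + S + s} \<inter> L = {}"
      by (intro exI[of _ "a - r k"]) auto
  qed blast
  define w where "w k x = (if x < n - 1 then u (x * n + k) else W k)" for k x
  interpret line_arrangement n w
    using assms(4) u(1) W(1) by unfold_locales (auto simp: n_def w_def)
  have length_line': "length (line k) = W k + r k" for k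
  proof -
    have "{..<n} = insert (n - 1) {..<n - 1}"
      using n2 by auto
    then show ?thesis
      unfolding length_line by (simp add: w_def r_def)
  qed
  have one_sided: "card {k. used c (k, n - 1, 0)} = 1" if "L_cycle L verts edges c" for c
  proof -
    have c: "is_cycle verts edges c" "length c \<in> L"
      using that by (auto simp: L_cycle_def)
    define K where "K = {k. used c (k, n - 1, 0)}"
    define Q where "Q = {(k, x). used c (k, x, 0) \<and> x < n - 1}"
    have "K \<subseteq> {..<n}"
      by (auto simp: K_def used_def arcs_def)
    then have "finite K"
      by (rule finite_subset) simp
    have Q: "Q \<subseteq> {..<n} \<times> {..<n - 1}"
      by (auto simp: Q_def used_def arcs_def)
    then have "finite Q"
      by (rule finite_subset) simp
    have "x < n - 1 \<or> x = n - 1" if "used c (k, x, 0)" for k x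
      using that by (auto simp: used_def arcs_def)
    then have "{(k, x). used c (k, x, 0)} = Q \<union> (\<lambda>k. (k, n - 1)) ` K"
      using n2 by (auto simp: Q_def K_def)
    then have "length c = (\<Sum>(k, x)\<in>Q \<union> (\<lambda>k. (k, n - 1)) ` K. w k x)"
      using length_cycle[OF c(1)] by simp
    also have "\<dots> = (\<Sum>(k, x)\<in>Q. w k x) + (\<Sum>(k, x)\<in>(\<lambda>k. (k, n - 1)) ` K. w k x)"
      using \<open>finite K\<close> \<open>finite Q\<close> by (intro sum.union_disjoint) (auto simp: Q_def)
    also have "(\<Sum>(k, x)\<in>(\<lambda>k. (k, n - 1)) ` K. w k x) = sum W K"
      by (subst sum.reindex) (auto simp: inj_on_def w_def)
    also have "(\<Sum>(k, x)\<in>Q. w k x) = (\<Sum>(k, x)\<in>Q. u (x * n + k))"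
      by (intro sum.cong) (auto simp: Q_def w_def)
    finally have len: "length c = (\<Sum>(k, x)\<in>Q. u (x * n + k)) + sum W K" .
    have "K \<noteq> {}"
    proof
      assume "K = {}"
      then have len': "length c = (\<Sum>(k, x)\<in>Q. u (x * n + k))"
        using len by simp
      have "inj_on (\<lambda>(k, x). x * n + k) Q"
      proof (rule inj_onI, clarify)
        fix k x k' x' assume "(k, x) \<in> Q" "(k', x') \<in> Q" and eq: "x * n + k = x' * n + k'"
        then have "k < n" "k' < n"
          using Q by auto
        then show "k = k' \<and> x = x'"
          using arg_cong[OF eq, of "\<lambda>i. i mod n"] arg_cong[OF eq, of "\<lambda>i. i div n"] by simp
      qed
      then have len'': "length c = sum u ((\<lambda>(k, x). x * n + k) ` Q)"
        unfolding len' by (subst sum.reindex) (auto simp: case_prod_beta)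
      have "Q \<noteq> {}"
        using len' c(1) by (auto simp: is_cycle_def)
      then obtain q where "u q \<le> length c" "length c \<le> u q + (\<Sum>p<q. u p)"
        using sum_between_Max[of "(\<lambda>(k, x). x * n + k) ` Q" u] \<open>finite Q\<close> len'' by auto
      then show False
        using u(2)[of q] c(2) by auto
    qed
    then obtain k where k: "k \<in> K" "sum W K \<le> W k + (\<Sum>j<k. W j)"
      using sum_between_Max \<open>finite K\<close> by metis
    have "(\<Sum>(k, x)\<in>Q. u (x * n + k)) \<le> (\<Sum>(k, x)\<in>{..<n} \<times> {..<n - 1}. u (x * n + k))"
      using Q by (intro sum_mono2) auto
    also have "\<dots> = S"
      by (simp add: S_def r_def sum.cartesian_product)
    finally have "length c \<le> W k + S + (\<Sum>j<k. W j)"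
      using len k by simp
    then have le: "length c \<le> W k + r k"
      using W(4)[of k] c(2) by (meson disjoint_iff greaterThanAtMost_iff not_le)
    have "K \<subseteq> {k}"
    proof (rule ccontr)
      assume "\<not> K \<subseteq> {k}"
      then obtain j where j: "j \<in> K" "j \<noteq> k" by auto
      then have "W k + W j = sum W {j, k}" by simp
      also have "\<dots> \<le> sum W K"
        using j k \<open>finite K\<close> by (intro sum_mono2) auto
      \<comment> \<open>Every \<open>W j\<close> exceeds \<open>S\<close>, so a second segment at
        infinity makes the cycle longer than line \<open>k\<close>, against
        \<open>le\<close>.\<close>
      finally have "W k + S < length c"
        using len W(2)[of j] by simp
      moreover have "r k \<le> S"
        using k \<open>K \<subseteq> {..<n}\<close> by (intro r_le) auto
      ultimately show False
        using le by simp
    qed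
    with k have "K = {k}" by blast
    then show ?thesis
      by (simp add: K_def)
  qed
  have "l \<le> card {length c |c. L_cycle L (verts - X) (delete_edges edges X) c}"
    if X: "X \<subseteq> verts" "card X \<le> l" for X
  proof -
    define K where "K = {k. k < n \<and> set (line k) \<inter> X = {}}"
    have "l \<le> card K"
      using card_surviving_lines[of X] finite_subset[OF X(1) finite_verts] X(2)
      by (simp add: K_def n_def)
    also have "card K = card ((\<lambda>k. length (line k)) ` K)"
    proof (rule card_image[symmetric])
      \<comment> \<open>\<open>W k\<close> alone exceeds \<open>W j + S\<close>, and
        \<open>r j\<close> is at most \<open>S\<close>.\<close>
      have "length (line j) < length (line k)" if "j < k" "j < n" for j k
      proof -
        have "W j \<le> (\<Sum>j<k. W j)"
          using that by (intro member_le_sum) auto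
        then show ?thesis
          using W(2)[of k] r_le[OF that(2)] by (simp add: length_line')
      qed
      then show "inj_on (\<lambda>k. length (line k)) K"
        by (intro linorder_inj_onI) (auto simp: K_def, force)
    qed
    also have "\<dots> \<le> card {length c |c. L_cycle L (verts - X) (delete_edges edges X) c}"
    proof (rule card_mono)
      show "finite {length c |c. L_cycle L (verts - X) (delete_edges edges X) c}"
        by (rule finite_L_cycle_lengths) (simp add: finite_verts)
      have "L_cycle L (verts - X) (delete_edges edges X) (line k)" if "k \<in> K" for k
        using that W(3)[of k] line_is_cycle[of k X] by (simp add: L_cycle_def K_def length_line')
      then show "(\<lambda>k. length (line k)) ` K \<subseteq>
          {length c |c. L_cycle L (verts - X) (delete_edges edges X) c}"
        by blast
    qed
    finally show ?thesis .
  qed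
  moreover have "\<nexists>c d. L_cycle L verts edges c \<and> L_cycle L verts edges d \<and> set c \<inter> set d = {}"
    using one_sided one_sided_cycles_intersect unfolding L_cycle_def by blast
  ultimately show ?thesis
    using finite_graph_arrangement projective_planar_arrangement by blast
qed

end
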